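(* Let $N_t$ be the Galton–Watson process in the i.i.d. random environment $\omega=(p_t,\alpha_t)_{t\ge1}$ with generalized geometric offspring laws, and suppose $\ln\frac{\beta_1}{p_1}$ is integrable. If $\mathcal{E}\ln\frac{\beta_1}{p_1}<0$, then for $P_m$-almost every environment $\omega$, as $t\to\infty$, $E^\omega[N_t]\to0$ exponentially fast and $P^\omega(N_t\ge1)\to0$ exponentially fast; that is, $$\limsup_{t\to\infty}\frac1t\ln E^\omega[N_t]<0\qquad\text{and}\qquad \limsup_{t\to\infty}\frac1t\ln P^\omega(N_t\ge1)<0 .$$
   Context: Environment: $(p_t,\alpha_t)$, $t\ge1$, are i.i.d. random vectors with values in $(0,1)^2$ ($p_t$ and $\alpha_t$ with the same $t$ may be dependent); $\beta_t=1-\alpha_t$; $\omega=(p_t,\alpha_t)_{t\ge1}$; $P_m$ is the law of the environment. $\mathcal{E}$ denotes total (annealed) expectation, which for functions of the environment is expectation under $P_m$. Given $\omega$, $N_0=1$ and $N_t=\sum_{i=1}^{N_{t-1}}\xi_{t,i}$, where under the quenched (conditional given $\omega$) law $P^\omega$ all $\xi_{t,i}$ are independent with $P^\omega(\xi_{t,i}=0)=\alpha_t$, $P^\omega(\xi_{t,i}=k)=(1-\alpha_t)p_t(1-p_t)^{k-1}$ for $k\ge1$. $E^\omega$ is expectation under $P^\omega$. *)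

theory Defs
  imports "HOL-Probability.Probability"
begin

type_synonym env = "nat \<Rightarrow> real \<times> real"

definition env_p :: "env \<Rightarrow> nat \<Rightarrow> real"
  where "env_p \<omega> t = fst (\<omega> t)"

definition env_alpha :: "env \<Rightarrow> nat \<Rightarrow> real"
  where "env_alpha \<omega> t = snd (\<omega> t)"

definition env_beta :: "env \<Rightarrow> nat \<Rightarrow> real"
  where "env_beta \<omega> t = 1 - env_alpha \<omega> t"

definition unit_square :: "(real \<times> real) measure"
  where "unit_square = restrict_space borel ({0<..<1} \<times> {0<..<1})"

text \<open>
  The measure \<open>Pm\<close> is the law of the environment \<open>\<omega> = (p\<^sub>t, \<alpha>\<^sub>t)\<close>, \<open>t \<ge> 1\<close>, on the space of
  sequences with values in the open unit square; generations are indexed from 1, so environments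
  are \<open>undefined\<close> at index 0. Within a pair, \<open>p\<^sub>t\<close> and \<open>\<alpha>\<^sub>t\<close> may be dependent.
\<close>

locale iid_environment = prob_space Pm for Pm :: "env measure" +
  assumes sets_env: "sets Pm = sets (PiM {1..} (\<lambda>_. unit_square))"
    and indep_env: "indep_vars (\<lambda>_. unit_square) (\<lambda>t \<omega>. \<omega> t) {1..}"
    and ident_env: "\<And>t. t \<ge> 1 \<Longrightarrow>
      distr Pm unit_square (\<lambda>\<omega>. \<omega> t) = distr Pm unit_square (\<lambda>\<omega>. \<omega> 1)"

text \<open>
  The measure \<open>Q\<close> is the quenched law given the environment \<open>\<omega>\<close>; the variable \<open>\<xi> t i\<close> is the
  offspring number of the \<open>i\<close>-th individual of generation \<open>t - 1\<close>. Any probability space carrying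
  such a family is allowed.
\<close>

locale quenched_offspring = prob_space Q for Q :: "'x measure" +
  fixes \<omega> :: env and \<xi> :: "nat \<Rightarrow> nat \<Rightarrow> 'x \<Rightarrow> nat"
  assumes indep_offspring:
      "indep_vars (\<lambda>_. count_space UNIV) (\<lambda>(t, i). \<xi> t i) ({1..} \<times> {1..})"
    and offspring_0: "\<And>t i. t \<ge> 1 \<Longrightarrow> i \<ge> 1 \<Longrightarrow>
      prob {x \<in> space Q. \<xi> t i x = 0} = env_alpha \<omega> t"
    and offspring_pos: "\<And>t i k. t \<ge> 1 \<Longrightarrow> i \<ge> 1 \<Longrightarrow> k \<ge> 1 \<Longrightarrow>
      prob {x \<in> space Q. \<xi> t i x = k} =
        (1 - env_alpha \<omega> t) * env_p \<omega> t * (1 - env_p \<omega> t) ^ (k - 1)"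

primrec galton_watson :: "(nat \<Rightarrow> nat \<Rightarrow> 'x \<Rightarrow> nat) \<Rightarrow> nat \<Rightarrow> 'x \<Rightarrow> nat" where
  "galton_watson \<xi> 0 x = 1"
| "galton_watson \<xi> (Suc t) x = (\<Sum>i = 1..galton_watson \<xi> t x. \<xi> (Suc t) i x)"

end

theory Submission imports Defs begin

text \<open>
  The quenched mean of the \<open>t\<close>-th generation is the product of the quotients \<open>\<beta>\<^sub>i / p\<^sub>i\<close>, so its
  logarithm is a random walk with integrable steps of negative mean, and by Markov's inequality it
  bounds the logarithm of the survival probability. Only an upper bound of the strong law is needed:
  partial sums of i.i.d. variables of negative mean are almost surely bounded above. Indeed, by
  Kolmogorov's 0-1 law they are otherwise unbounded almost surely, and then the maximal ergodic
  inequality forces the mean to be nonnegative. Applying this to the steps increased by a small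
  constant gives a linear negative drift.
\<close>

section \<open>Maxima and boundedness of the partial sums of a real sequence\<close>

text \<open>This is the maximum over k \<le> n of the sums of the first k terms, the empty sum
  included. Peeling off the first term relates it directly to the maximum for the shifted sequence,
  as the maximal inequality requires.\<close>

primrec max_sum :: "nat \<Rightarrow> (nat \<Rightarrow> real) \<Rightarrow> real" where
  "max_sum 0 a = 0"
| "max_sum (Suc n) a = max 0 (a 0 + max_sum n (\<lambda>i. a (Suc i)))"

lemma max_sum_nonneg: "0 \<le> max_sum n a"
  by (cases n) auto

lemma max_sum_le_Suc: "max_sum n a \<le> max_sum (Suc n) a"
proof (induction n arbitrary: a)
  case (Suc n)
  show ?case
    unfolding max_sum.simps(2)[of n a] max_sum.simps(2)[of "Suc n" a]
    by (intro max.mono add_left_mono Suc order_refl)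
qed simp

lemma sum_le_max_sum: "(\<Sum>i<n. a i) \<le> max_sum n a"
proof (induction n arbitrary: a)
  case (Suc n)
  have "(\<Sum>i<Suc n. a i) = a 0 + (\<Sum>i<n. a (Suc i))"
    by (rule sum.lessThan_Suc_shift)
  with Suc[of "\<lambda>i. a (Suc i)"] show ?case by simp
qed simp

lemma max_sum_mono: "m \<le> n \<Longrightarrow> max_sum m a \<le> max_sum n a"
  using lift_Suc_mono_le[of "\<lambda>n. max_sum n a"] max_sum_le_Suc by blast

lemma measurable_max_sum [measurable]:
  "max_sum n \<in> borel_measurable (PiM UNIV (\<lambda>_. borel))"
proof (induction n)
  case (Suc n)
  note [measurable] = Suc
  have [measurable]: "(\<lambda>a i. a (Suc i)) \<in> PiM UNIV (\<lambda>_. borel) \<rightarrow>\<^sub>M PiM UNIV (\<lambda>_. borel :: real measure)"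
    by (intro measurable_PiM_single') auto
  show ?case by simp
qed simp

lemma integrable_max_sum:
  assumes "\<And>i. integrable M (Y i)"
  shows "integrable M (\<lambda>x. max_sum n (\<lambda>i. Y i x))"
  using assms
proof (induction n arbitrary: Y)
  case (Suc n)
  from Suc.IH[of "\<lambda>i. Y (Suc i)"] Suc.prems show ?case by simp
qed simp

text \<open>The first m terms change later sums by a constant only, and finitely many sums are
  always bounded. The right-hand side involves only indices from m on, which makes unboundedness a
  tail event; a natural number as bound keeps the quantifiers countable, hence measurable.\<close>

lemma bdd_above_partial_sums_iff:
  fixes a :: "nat \<Rightarrow> real"
  shows "bdd_above (range (\<lambda>n. \<Sum>i<n. a i)) \<longleftrightarrow> (\<exists>K::nat. \<forall>n. (\<Sum>i\<in>{m..<m+n}. a i) \<le> real K)"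
proof -
  have split: "(\<Sum>i<m+n. a i) = (\<Sum>i<m. a i) + (\<Sum>i\<in>{m..<m+n}. a i)" for n
    using sum.atLeastLessThan_concat[of 0 m "m+n" a] by (simp add: lessThan_atLeast0)
  show ?thesis
  proof
    assume "bdd_above (range (\<lambda>n. \<Sum>i<n. a i))"
    then obtain C where C: "\<And>n. (\<Sum>i<n. a i) \<le> C"
      by (auto simp: bdd_above_def)
    obtain K :: nat where "C - (\<Sum>i<m. a i) \<le> real K"
      using real_arch_simple by blast
    then have "(\<Sum>i\<in>{m..<m+n}. a i) \<le> real K" for n
      using C[of "m+n"] split[of n] by linarith
    then show "\<exists>K::nat. \<forall>n. (\<Sum>i\<in>{m..<m+n}. a i) \<le> real K" by blast
  next
    assume "\<exists>K::nat. \<forall>n. (\<Sum>i\<in>{m..<m+n}. a i) \<le> real K"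
    then obtain K :: nat where K: "\<And>n. (\<Sum>i\<in>{m..<m+n}. a i) \<le> real K" by blast
    \<comment> \<open>One bound for both cases: \<open>Max\<close> is nonnegative because it
      includes the empty sum, and the absolute values keep the bracket large enough for either sign
      of the initial sum.\<close>
    have "(\<Sum>i<n. a i) \<le> Max ((\<lambda>n. \<Sum>i<n. a i) ` {..m}) + ((\<Sum>i<m. \<bar>a i\<bar>) + (\<Sum>i<m. a i) + real K)" for n
    proof (cases "n \<le> m")
      case True
      have "(\<Sum>i<n. a i) \<le> Max ((\<lambda>n. \<Sum>i<n. a i) ` {..m})" using True by (intro Max_ge) auto
      moreover have "0 \<le> (\<Sum>i<m. \<bar>a i\<bar>) + (\<Sum>i<m. a i)"
        by (simp flip: sum.distrib) (auto intro!: sum_nonneg)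
      ultimately show ?thesis by simp
    next
      case False
      then have "(\<Sum>i<n. a i) \<le> (\<Sum>i<m. a i) + real K"
        using split[of "n-m"] K[of "n-m"] by simp
      moreover have "0 \<le> Max ((\<lambda>n. \<Sum>i<n. a i) ` {..m})"
        using Max_ge[of "(\<lambda>n. \<Sum>i<n. a i) ` {..m}" "\<Sum>i<0. a i"] by fastforce
      moreover have "0 \<le> (\<Sum>i<m. \<bar>a i\<bar>)" by (simp add: sum_nonneg)
      ultimately show ?thesis by linarith
    qed
    then show "bdd_above (range (\<lambda>n. \<Sum>i<n. a i))" by (rule bdd_aboveI2)
  qed
qed

section \<open>The one-sided strong law for i.i.d. sequences\<close>

context prob_space
begin

text \<open>Independence concerns finite subfamilies, and an injective map carries products over J
  to products over its image. Used for index shifts.\<close>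

lemma indep_vars_reindex:
  assumes indep: "indep_vars M' X (f ` I)" and inj: "inj_on f I"
  shows "indep_vars (\<lambda>i. M' (f i)) (\<lambda>i. X (f i)) I"
proof -
  have "indep_sets (\<lambda>i. F (f i)) I" if F: "indep_sets F (f ` I)" for F :: "_ \<Rightarrow> 'a set set"
  proof (rule indep_setsI)
    fix i assume "i \<in> I"
    with F show "F (f i) \<subseteq> events" by (auto simp: indep_sets_def)
  next
    fix A J assume J: "J \<noteq> {}" "J \<subseteq> I" "finite J" and A: "\<forall>j\<in>J. A j \<in> F (f j)"
    have injJ: "inj_on f J" using inj J(2) by (rule inj_on_subset)
    define B where "B = (\<lambda>k. A (the_inv_into J f k))"
    have B: "B (f j) = A j" if "j \<in> J" for j
      using that injJ by (simp add: B_def the_inv_into_f_f)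
    have "prob (\<Inter>k\<in>f ` J. B k) = (\<Prod>k\<in>f ` J. prob (B k))"
      using J A by (intro indep_setsD[OF F]) (auto simp: B)
    then show "prob (\<Inter> (A ` J)) = (\<Prod>j\<in>J. prob (A j))"
      by (simp add: B prod.reindex[OF injJ])
  qed
  from this[of "\<lambda>i. {X i -` A \<inter> space M | A. A \<in> sets (M' i)}"] indep show ?thesis
    by (auto simp: indep_vars_def2)
qed

text \<open>By independence both joint laws are the product of their marginals, and the marginals
  agree.\<close>

lemma distr_iid_shift:
  fixes Y :: "nat \<Rightarrow> 'a \<Rightarrow> real"
  assumes indep: "indep_vars (\<lambda>_. borel) Y UNIV"
    and ident: "\<And>i. distr M borel (Y i) = distr M borel (Y 0)"
  shows "distr M (PiM UNIV (\<lambda>_. borel)) (\<lambda>x i. Y (Suc i) x) =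
         distr M (PiM UNIV (\<lambda>_. borel)) (\<lambda>x i. Y i x)"
proof -
  have rv: "\<And>i. random_variable borel (Y i)"
    using indep by (auto simp: indep_vars_def)
  have "indep_vars (\<lambda>_. borel) (\<lambda>i. Y (Suc i)) UNIV"
    by (rule indep_vars_reindex[OF indep_vars_subset[OF indep]]) auto
  moreover have "(\<lambda>i. distr M borel (Y (Suc i))) = (\<lambda>i. distr M borel (Y i))"
    using ident by metis
  ultimately show ?thesis
    using indep indep_vars_iff_distr_eq_PiM[where I = UNIV and M' = "\<lambda>_. borel" and X = Y]
      indep_vars_iff_distr_eq_PiM[where I = UNIV and M' = "\<lambda>_. borel" and X = "\<lambda>i. Y (Suc i)"] rv
    by (simp add: restrict_UNIV)
qed

text \<open>The maximal ergodic inequality: on the event, \<open>Y 0\<close> exceeds the drop of \<open>max_sum\<close> under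
  the shift, and the two maxima have the same mean.\<close>

lemma maximal_inequality:
  fixes Y :: "nat \<Rightarrow> 'a \<Rightarrow> real"
  assumes indep: "indep_vars (\<lambda>_. borel) Y UNIV"
    and ident: "\<And>i. distr M borel (Y i) = distr M borel (Y 0)"
    and int: "integrable M (Y 0)"
  shows "0 \<le> (\<integral>x. indicator {x \<in> space M. 0 < max_sum n (\<lambda>i. Y i x)} x * Y 0 x \<partial>M)"
proof -
  have rv [measurable]: "\<And>i. random_variable borel (Y i)"
    using indep by (auto simp: indep_vars_def)
  have intY: "integrable M (Y i)" for i
    using int integrable_distr_eq[OF rv[of i], of "\<lambda>x. x"] integrable_distr_eq[OF rv[of 0], of "\<lambda>x. x"]
    by (simp add: ident[of i])
  define W where "W = (\<lambda>x. max_sum n (\<lambda>i. Y i x))"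
  define V where "V = (\<lambda>x. max_sum n (\<lambda>i. Y (Suc i) x))"
  have intW: "integrable M W" and intV: "integrable M V"
    unfolding W_def V_def by (auto intro!: integrable_max_sum intY)
  then have [measurable]: "W \<in> borel_measurable M" "V \<in> borel_measurable M" by auto
  have [measurable]: "random_variable (PiM UNIV (\<lambda>_. borel)) (\<lambda>x i. Y i x)"
    "random_variable (PiM UNIV (\<lambda>_. borel)) (\<lambda>x i. Y (Suc i) x)"
    by (auto intro!: measurable_PiM_single')
  have "expectation W = (\<integral>a. max_sum n a \<partial>distr M (PiM UNIV (\<lambda>_. borel)) (\<lambda>x i. Y i x))"
    unfolding W_def by (subst integral_distr) auto
  also have "\<dots> = expectation V"
    unfolding V_def distr_iid_shift[OF indep ident, symmetric] by (subst integral_distr) auto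
  finally have "0 = (\<integral>x. W x - V x \<partial>M)"
    using intW intV by simp
  also have "\<dots> \<le> (\<integral>x. indicator {x \<in> space M. 0 < W x} x * Y 0 x \<partial>M)"
  proof (rule integral_mono)
    show "integrable M (\<lambda>x. indicator {x \<in> space M. 0 < W x} x * Y 0 x)"
      using integrable_mult_indicator[OF _ int, of "{x \<in> space M. 0 < W x}"] by simp
    fix x assume x: "x \<in> space M"
    show "W x - V x \<le> indicator {x \<in> space M. 0 < W x} x * Y 0 x"
    proof (cases "0 < W x")
      case True
      \<comment> \<open>The right-hand side is the maximum of 0 and \<open>Y 0 x + V x\<close>;
        positivity of \<open>W x\<close> rules out the 0.\<close>
      have "W x \<le> max_sum (Suc n) (\<lambda>i. Y i x)" unfolding W_def by (rule max_sum_le_Suc)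
      with True have "W x \<le> Y 0 x + V x" by (simp add: V_def split: if_splits)
      with True x show ?thesis by simp
    next
      case False
      with max_sum_nonneg[of n "\<lambda>i. Y (Suc i) x"] show ?thesis by (simp add: V_def)
    qed
  qed (use intW intV in auto)
  finally show ?thesis by (simp add: W_def)
qed

text \<open>The event can be written through the variables from any m on, so it lies in the tail
  sigma-algebra and Kolmogorov's law applies.\<close>

lemma unbounded_partial_sums_0_1:
  fixes Y :: "nat \<Rightarrow> 'a \<Rightarrow> real"
  assumes indep: "indep_vars (\<lambda>_. borel) Y UNIV"
  defines "A \<equiv> {x \<in> space M. \<not> bdd_above (range (\<lambda>n. \<Sum>i<n. Y i x))}"
  shows "A \<in> events" and "prob A = 0 \<or> prob A = 1"
proof -
  let ?F = "\<lambda>i. sigma_sets (space M) {Y i -` B \<inter> space M | B. B \<in> sets borel}"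
  have rv [measurable]: "\<And>i. random_variable borel (Y i)"
    using indep by (auto simp: indep_vars_def)
  have sub: "(\<Union>i\<in>J. ?F i) \<subseteq> Pow (space M)" for J
    using sigma_sets_into_sp[of "{Y _ -` B \<inter> space M | B. B \<in> sets borel}" "space M"] by blast
  have A_eq: "A = {x \<in> space M. \<not> (\<exists>K::nat. \<forall>n. (\<Sum>i\<in>{m..<m+n}. Y i x) \<le> real K)}" for m
    unfolding A_def bdd_above_partial_sums_iff[where m = m] ..
  show "A \<in> events" unfolding A_eq[of 0] by measurable
  have "A \<in> sigma_sets (space M) (\<Union>i\<in>{m..}. ?F i)" for m
  proof -
    \<comment> \<open>\<open>?N\<close> carries only the information in the variables from m
      on.\<close>
    let ?N = "sigma (space M) (\<Union>i\<in>{m..}. ?F i)"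
    have sp: "space ?N = space M" by (simp add: space_measure_of_conv)
    have [measurable]: "Y i \<in> borel_measurable ?N" if "i \<in> {m..<m+n}" for i n
    proof (rule measurableI)
      fix B :: "real set" assume "B \<in> sets borel"
      then have "Y i -` B \<inter> space M \<in> (\<Union>i\<in>{m..}. ?F i)"
        using that by (auto intro!: bexI[of _ i] sigma_sets.Basic)
      then show "Y i -` B \<inter> space ?N \<in> sets ?N"
        using sub[of "{m..}"] by (simp add: sp)
    qed simp
    have "{x \<in> space ?N. \<not> (\<exists>K::nat. \<forall>n. (\<Sum>i\<in>{m..<m+n}. Y i x) \<le> real K)} \<in> sets ?N"
      by measurable
    then show ?thesis using sub[of "{m..}"] by (simp add: A_eq[of m] sp)
  qed
  then have "A \<in> tail_events ?F" by (auto simp: tail_events_def)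
  moreover have "sigma_algebra (space M) (?F i)" for i
    by (rule sigma_algebra_sigma_sets) auto
  ultimately show "prob A = 0 \<or> prob A = 1"
    using kolmogorov_0_1_law[of ?F A] indep by (auto simp: indep_vars_def)
qed

text \<open>If the sums were almost surely unbounded, the events of the maximal inequality would
  exhaust the space, and its limit would contradict the negative mean.\<close>

lemma iid_partial_sums_bounded:
  fixes Y :: "nat \<Rightarrow> 'a \<Rightarrow> real"
  assumes indep: "indep_vars (\<lambda>_. borel) Y UNIV"
    and ident: "\<And>i. distr M borel (Y i) = distr M borel (Y 0)"
    and int: "integrable M (Y 0)" and neg: "expectation (Y 0) < 0"
  shows "AE x in M. bdd_above (range (\<lambda>n. \<Sum>i<n. Y i x))"
proof -
  have rv [measurable]: "\<And>i. random_variable borel (Y i)"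
    using indep by (auto simp: indep_vars_def)
  have [measurable]: "random_variable (PiM UNIV (\<lambda>_. borel)) (\<lambda>x i. Y i x)"
    by (auto intro!: measurable_PiM_single')
  let ?A = "{x \<in> space M. \<not> bdd_above (range (\<lambda>n. \<Sum>i<n. Y i x))}"
  let ?B = "\<lambda>n. {x \<in> space M. 0 < max_sum n (\<lambda>i. Y i x)}"
  note A = unbounded_partial_sums_0_1[OF indep]
  have "prob ?A \<noteq> 1"
  proof
    assume "prob ?A = 1"
    then have AE: "AE x in M. x \<in> ?A" using prob_Collect_eq_1 A(1) by (simp add: AE_in_set_eq_1)
    have "(\<lambda>n. \<integral>x. indicator (?B n) x * Y 0 x \<partial>M) \<longlonglongrightarrow> expectation (Y 0)"
    proof (rule integral_dominated_convergence[where w = "\<lambda>x. \<bar>Y 0 x\<bar>"])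
      show "AE x in M. (\<lambda>n. indicator (?B n) x * Y 0 x) \<longlonglongrightarrow> Y 0 x"
        using AE
      proof eventually_elim
        fix x assume x: "x \<in> ?A"
        \<comment> \<open>On an unbounded path 0 is not an upper bound. From such an N on, the
          maximum stays positive, so the integrand is constant in n.\<close>
        then obtain N where N: "0 < (\<Sum>i<N. Y i x)"
          by (force simp: bdd_above_def not_le)
        have "indicator (?B n) x * Y 0 x = Y 0 x" if "N \<le> n" for n
          using N sum_le_max_sum[of "\<lambda>i. Y i x" N] max_sum_mono[OF that, of "\<lambda>i. Y i x"] x by simp
        then show "(\<lambda>n. indicator (?B n) x * Y 0 x) \<longlonglongrightarrow> Y 0 x"
          by (intro tendsto_eventually eventually_sequentiallyI[of N])
      qed
    qed (use int in \<open>auto simp: indicator_def\<close>)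
    then have "0 \<le> expectation (Y 0)"
      by (rule LIMSEQ_le_const) (use maximal_inequality[OF indep ident int] in blast)
    with neg show False by simp
  qed
  with A have "prob ?A = 0" by blast
  with A(1) show ?thesis by (subst AE_iff_measurable[OF A(1)]) (auto simp: emeasure_eq_measure)
qed

lemma iid_average_limsup_neg:
  fixes Y :: "nat \<Rightarrow> 'a \<Rightarrow> real"
  assumes indep: "indep_vars (\<lambda>_. borel) Y UNIV"
    and ident: "\<And>i. distr M borel (Y i) = distr M borel (Y 0)"
    and int: "integrable M (Y 0)" and neg: "expectation (Y 0) < 0"
  shows "AE x in M. limsup (\<lambda>n. ereal (1 / real n * (\<Sum>i<n. Y i x))) < 0"
proof -
  have rv [measurable]: "\<And>i. random_variable borel (Y i)"
    using indep by (auto simp: indep_vars_def)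
  \<comment> \<open>Half the drift: the steps increased by c still have negative mean, namely -c,
    and the averages of the original steps are at most K/n - c.\<close>
  define c where "c = - expectation (Y 0) / 2"
  have c: "0 < c" using neg by (simp add: c_def)
  have "AE x in M. bdd_above (range (\<lambda>n. \<Sum>i<n. Y i x + c))"
  proof (rule iid_partial_sums_bounded)
    show "indep_vars (\<lambda>_. borel) (\<lambda>i x. Y i x + c) UNIV"
      by (rule indep_vars_compose2[OF indep]) auto
    fix i
    have "distr M borel (\<lambda>x. Y i x + c) = distr (distr M borel (Y i)) borel (\<lambda>y. y + c)" for i
      by (subst distr_distr) (auto simp: comp_def)
    then show "distr M borel (\<lambda>x. Y i x + c) = distr M borel (\<lambda>x. Y 0 x + c)"
      by (simp add: ident[of i])
  qed (use int neg in \<open>auto simp: c_def prob_space\<close>)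
  then show ?thesis
  proof eventually_elim
    fix x assume "bdd_above (range (\<lambda>n. \<Sum>i<n. Y i x + c))"
    then obtain K where K: "\<And>n. (\<Sum>i<n. Y i x + c) \<le> K"
      by (auto simp: bdd_above_def)
    have "(\<lambda>n. K / real n) \<longlonglongrightarrow> 0" by (rule lim_const_over_n)
    then have "\<forall>\<^sub>F n in sequentially. K / real n < c / 2"
      using c by (intro order_tendstoD) auto
    then have "\<forall>\<^sub>F n in sequentially. ereal (1 / real n * (\<Sum>i<n. Y i x)) \<le> ereal (- c / 2)"
      using eventually_gt_at_top[of 0]
    proof eventually_elim
      case (elim n)
      have "(\<Sum>i<n. Y i x) \<le> K - real n * c" using K[of n] by (simp add: sum.distrib)
      then have "1 / real n * (\<Sum>i<n. Y i x) \<le> K / real n - c"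
        using elim by (simp add: field_simps)
      with elim have "1 / real n * (\<Sum>i<n. Y i x) \<le> - c / 2" by linarith
      then show ?case by simp
    qed
    then have "limsup (\<lambda>n. ereal (1 / real n * (\<Sum>i<n. Y i x))) \<le> ereal (- c / 2)"
      by (rule Limsup_bounded)
    also have "\<dots> < 0" using c by simp
    finally show "limsup (\<lambda>n. ereal (1 / real n * (\<Sum>i<n. Y i x))) < 0" .
  qed
qed

end

section \<open>Means of products and of counting variables\<close>

text \<open>With values in \<open>ennreal\<close> no integrability is presupposed, so finiteness of
  the quenched means can come out of their recursion. The pair is treated as an independent family
  over \<open>bool\<close>.\<close>

lemma indep_var_nn_integral_mult:
  fixes X Y :: "'a \<Rightarrow> ennreal"
  assumes "prob_space M" and "prob_space.indep_var M borel X borel Y"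
  shows "(\<integral>\<^sup>+x. X x * Y x \<partial>M) = (\<integral>\<^sup>+x. X x \<partial>M) * (\<integral>\<^sup>+x. Y x \<partial>M)"
proof -
  interpret prob_space M by fact
  have "(\<integral>\<^sup>+x. (\<Prod>b\<in>UNIV. (case_bool X Y b) x) \<partial>M) = (\<Prod>b\<in>UNIV. \<integral>\<^sup>+x. (case_bool X Y b) x \<partial>M)"
  proof (rule indep_vars_nn_integral)
    have "(case_bool borel borel :: bool \<Rightarrow> ennreal measure) = (\<lambda>_. borel)"
      by (simp add: fun_eq_iff split: bool.split)
    with assms(2) show "indep_vars (\<lambda>_. borel) (case_bool X Y) UNIV" by (simp add: indep_var_def)
  qed auto
  then show ?thesis by (simp add: UNIV_bool mult.commute)
qed

text \<open>Decompose f over its level sets and exchange sum and integral; the offspring laws are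
  given by such point masses.\<close>

lemma nn_integral_nat_eq_suminf:
  assumes [measurable]: "f \<in> M \<rightarrow>\<^sub>M count_space UNIV"
  shows "(\<integral>\<^sup>+x. of_nat (f x) \<partial>M) = (\<Sum>k. of_nat k * emeasure M {x \<in> space M. f x = k})"
proof -
  have "(\<integral>\<^sup>+x. of_nat (f x) \<partial>M) = (\<integral>\<^sup>+x. (\<Sum>k. of_nat k * indicator {x \<in> space M. f x = k} x) \<partial>M)"
  proof (rule nn_integral_cong)
    fix x assume "x \<in> space M"
    then show "(of_nat (f x) :: ennreal) = (\<Sum>k. of_nat k * indicator {x \<in> space M. f x = k} x)"
      by (subst suminf_finite[of "{f x}"]) (auto simp: indicator_def)
  qed
  also have "\<dots> = (\<Sum>k. \<integral>\<^sup>+x. of_nat k * indicator {x \<in> space M. f x = k} x \<partial>M)"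
    by (rule nn_integral_suminf) measurable
  also have "\<dots> = (\<Sum>k. of_nat k * emeasure M {x \<in> space M. f x = k})"
    by (simp add: nn_integral_cmult)
  finally show ?thesis .
qed

section \<open>Measurability and independence in the branching process\<close>

text \<open>The two arrays may live on different sample spaces, as needed to pass to the space of
  arrays.\<close>

lemma galton_watson_cong:
  assumes "\<And>s i. 1 \<le> s \<Longrightarrow> s \<le> t \<Longrightarrow> 1 \<le> i \<Longrightarrow> \<xi> s i x = \<eta> s i y"
  shows "galton_watson \<xi> t x = galton_watson \<eta> t y"
  using assms by (induction t) (auto intro!: sum.cong)

text \<open>Taking the offspring array itself as the sample space turns the process into a measurable function
  of the first generations, which gives its independence of the later ones.\<close>

lemma measurable_galton_watson_array:
  assumes "t \<le> n"
  shows "galton_watson (\<lambda>s i \<eta>. \<eta> (s, i)) t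
    \<in> PiM ({1..n} \<times> {1..}) (\<lambda>_. count_space UNIV) \<rightarrow>\<^sub>M count_space UNIV"
  using assms
proof (induction t)
  case (Suc t)
  let ?P = "PiM ({1..n} \<times> {1..}) (\<lambda>_. count_space (UNIV :: nat set)) :: (nat \<times> nat \<Rightarrow> nat) measure"
  have [measurable]: "(\<lambda>\<eta>. \<eta> (Suc t, i)) \<in> ?P \<rightarrow>\<^sub>M count_space UNIV" if "i \<in> {1..m}" for i m
    using Suc.prems that by (intro measurable_component_singleton) auto
  have "(\<lambda>\<eta>. \<Sum>i = 1..m. \<eta> (Suc t, i)) \<in> ?P \<rightarrow>\<^sub>M count_space UNIV" for m
    by measurable
  \<comment> \<open>The random number of summands takes countably many values, so measurability for
    each fixed m suffices.\<close>
  then have "(\<lambda>\<eta>. \<Sum>i = 1..galton_watson (\<lambda>s i \<eta>. \<eta> (s, i)) t \<eta>. \<eta> (Suc t, i)) \<in> ?P \<rightarrow>\<^sub>M count_space UNIV"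
    by (rule measurable_compose_countable[where f = "\<lambda>m \<eta>. \<Sum>i = 1..m. \<eta> (Suc t, i)"])
       (use Suc in simp)
  then show ?case unfolding galton_watson.simps[abs_def] .
qed (simp add: galton_watson.simps(1)[abs_def])

context quenched_offspring
begin

lemma measurable_offspring [measurable (raw)]:
  "1 \<le> t \<Longrightarrow> 1 \<le> i \<Longrightarrow> \<xi> t i \<in> Q \<rightarrow>\<^sub>M count_space UNIV"
  using indep_offspring by (auto simp: indep_vars_def)

lemma galton_watson_array:
  "galton_watson \<xi> t x = galton_watson (\<lambda>s i \<eta>. \<eta> (s, i)) t (\<lambda>(s, i)\<in>{1..t} \<times> {1..}. \<xi> s i x)"
  by (rule galton_watson_cong) auto

lemma measurable_galton_watson [measurable]: "galton_watson \<xi> t \<in> Q \<rightarrow>\<^sub>M count_space UNIV"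
  unfolding galton_watson_array[abs_def]
  by (rule measurable_compose[OF _ measurable_galton_watson_array[OF order_refl]])
     (auto intro!: measurable_restrict measurable_offspring)

text \<open>The two variables are functions of disjoint blocks of the independent array: generations
  up to t, and one entry of generation t + 1.\<close>

lemma indep_galton_watson_offspring:
  assumes "1 \<le> i"
  shows "indep_var (count_space UNIV) (galton_watson \<xi> t) (count_space UNIV) (\<xi> (Suc t) i)"
proof -
  let ?A = "{1..t} \<times> {1..}" and ?B = "{(Suc t, i)}"
  have "indep_var (count_space UNIV)
      (galton_watson (\<lambda>s i \<eta>. \<eta> (s, i)) t \<circ> (\<lambda>x. \<lambda>p\<in>?A. (case p of (s, i) \<Rightarrow> \<xi> s i) x))
      (count_space UNIV) ((\<lambda>\<eta>. \<eta> (Suc t, i)) \<circ> (\<lambda>x. \<lambda>p\<in>?B. (case p of (s, i) \<Rightarrow> \<xi> s i) x))"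
  proof (rule indep_var_compose[OF indep_var_restrict[OF indep_offspring]
        measurable_galton_watson_array[OF order_refl]])
    show "(\<lambda>\<eta>. \<eta> (Suc t, i)) \<in> PiM ?B (\<lambda>_. count_space UNIV) \<rightarrow>\<^sub>M count_space UNIV"
      by (rule measurable_component_singleton) simp
  qed (use assms in auto)
  also have "galton_watson (\<lambda>s i \<eta>. \<eta> (s, i)) t \<circ> (\<lambda>x. \<lambda>p\<in>?A. (case p of (s, i) \<Rightarrow> \<xi> s i) x)
      = galton_watson \<xi> t"
    by (rule ext) (simp add: galton_watson_array[of t] case_prod_beta')
  also have "(\<lambda>\<eta>. \<eta> (Suc t, i)) \<circ> (\<lambda>x. \<lambda>p\<in>?B. (case p of (s, i) \<Rightarrow> \<xi> s i) x) = \<xi> (Suc t) i"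
    by (simp add: fun_eq_iff)
  finally show ?thesis .
qed

section \<open>Quenched mean and survival probability\<close>

lemma nn_integral_offspring:
  assumes t: "1 \<le> t" and i: "1 \<le> i" and p: "0 < env_p \<omega> t" "env_p \<omega> t < 1" and b: "0 \<le> env_beta \<omega> t"
  shows "(\<integral>\<^sup>+x. of_nat (\<xi> t i x) \<partial>Q) = ennreal (env_beta \<omega> t / env_p \<omega> t)"
proof -
  let ?p = "env_p \<omega> t" and ?b = "env_beta \<omega> t"
  let ?f = "\<lambda>k. real k * prob {x \<in> space Q. \<xi> t i x = k}"
  \<comment> \<open>The differentiated geometric series at 1 - p has the value 1/p^2, and the
    prefactor reduces this to \<beta>/p.\<close>
  have "(\<lambda>k. (?b * ?p) * (real (Suc k) * (1 - ?p) ^ k)) sums ((?b * ?p) * (1 / (1 - (1 - ?p))^2))"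
    using p by (intro sums_mult geometric_deriv_sums) auto
  also have "(\<lambda>k. (?b * ?p) * (real (Suc k) * (1 - ?p) ^ k)) = (\<lambda>k. ?f (Suc k))"
    using offspring_pos[OF t i, of "Suc _"] by (auto simp: env_beta_def fun_eq_iff)
  also have "(?b * ?p) * (1 / (1 - (1 - ?p))^2) = ?b / ?p"
    using p by (simp add: power2_eq_square)
  \<comment> \<open>The term at k = 0 vanishes, so the shifted series has the same sum.\<close>
  finally have "?f sums (?b / ?p)" by (subst (asm) sums_Suc_iff) simp
  then have "(\<Sum>k. ennreal (?f k)) = ennreal (?b / ?p)"
    by (intro suminf_ennreal_eq) auto
  then show ?thesis
    by (subst nn_integral_nat_eq_suminf[OF measurable_offspring[OF t i]])
       (simp add: emeasure_eq_measure ennreal_mult' ennreal_of_nat_eq_real_of_nat)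
qed

text \<open>Wald's argument: the random sum is a series of offspring numbers weighted by indicators
  of i < N_t. In each term the factors are independent, and the indicators add up to N_t
  again.\<close>

lemma nn_integral_galton_watson_Suc:
  assumes p: "0 < env_p \<omega> (Suc t)" "env_p \<omega> (Suc t) < 1" and b: "0 \<le> env_beta \<omega> (Suc t)"
  shows "(\<integral>\<^sup>+x. of_nat (galton_watson \<xi> (Suc t) x) \<partial>Q) =
    (\<integral>\<^sup>+x. of_nat (galton_watson \<xi> t x) \<partial>Q) * ennreal (env_beta \<omega> (Suc t) / env_p \<omega> (Suc t))"
proof -
  let ?N = "galton_watson \<xi> t" and ?m = "ennreal (env_beta \<omega> (Suc t) / env_p \<omega> (Suc t))"
  have [measurable]: "\<xi> (Suc t) (Suc i) \<in> Q \<rightarrow>\<^sub>M count_space UNIV" for i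
    by (rule measurable_offspring) auto
  have ind: "(\<Sum>i. (if i < n then f i else 0)) = (\<Sum>i<n. f i)" for f :: "nat \<Rightarrow> ennreal" and n
    by (subst suminf_finite[of "{..<n}"]) auto
  have "(\<integral>\<^sup>+x. of_nat (galton_watson \<xi> (Suc t) x) \<partial>Q) =
      (\<integral>\<^sup>+x. (\<Sum>i. (if i < ?N x then 1 else 0) * of_nat (\<xi> (Suc t) (Suc i) x)) \<partial>Q)"
    by (simp add: sum.atLeast1_atMost_eq ind if_distrib[of "\<lambda>a. a * _"] cong: if_cong)
  also have "\<dots> = (\<Sum>i. \<integral>\<^sup>+x. (if i < ?N x then 1 else 0) * of_nat (\<xi> (Suc t) (Suc i) x) \<partial>Q)"
    by (rule nn_integral_suminf) measurable
  also have "\<dots> = (\<Sum>i. (\<integral>\<^sup>+x. (if i < ?N x then 1 else 0) \<partial>Q) * ?m)"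
  proof (rule suminf_cong)
    fix i
    have "indep_var borel ((\<lambda>n. if i < n then 1 else 0 :: ennreal) \<circ> ?N)
        borel (of_nat \<circ> \<xi> (Suc t) (Suc i) :: _ \<Rightarrow> ennreal)"
      by (rule indep_var_compose[OF indep_galton_watson_offspring]) auto
    from indep_var_nn_integral_mult[OF prob_space_axioms this]
    show "(\<integral>\<^sup>+x. (if i < ?N x then 1 else 0) * of_nat (\<xi> (Suc t) (Suc i) x) \<partial>Q) =
        (\<integral>\<^sup>+x. (if i < ?N x then 1 else 0) \<partial>Q) * ?m"
      using nn_integral_offspring[OF _ _ p b, of "Suc i"] by (simp add: comp_def)
  qed
  also have "\<dots> = (\<Sum>i. \<integral>\<^sup>+x. (if i < ?N x then 1 else 0) \<partial>Q) * ?m"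
    by simp
  also have "(\<Sum>i. \<integral>\<^sup>+x. (if i < ?N x then 1 else 0) \<partial>Q) = (\<integral>\<^sup>+x. (\<Sum>i. if i < ?N x then 1 else 0) \<partial>Q)"
    by (rule nn_integral_suminf[symmetric]) measurable
  also have "\<dots> = (\<integral>\<^sup>+x. of_nat (?N x) \<partial>Q)"
    by (simp add: ind)
  finally show ?thesis .
qed

text \<open>Iterating the recursion gives a finite product, hence integrability; all factors are
  positive, so its logarithm is the random walk.\<close>

lemma
  assumes env: "\<forall>t\<ge>1. 0 < env_p \<omega> t \<and> env_p \<omega> t < 1 \<and> 0 < env_beta \<omega> t"
  shows nn_integral_galton_watson: "(\<integral>\<^sup>+x. of_nat (galton_watson \<xi> t x) \<partial>Q) =
      ennreal (\<Prod>i<t. env_beta \<omega> (Suc i) / env_p \<omega> (Suc i))"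
    and integrable_galton_watson: "integrable Q (\<lambda>x. real (galton_watson \<xi> t x))"
    and expectation_galton_watson: "expectation (\<lambda>x. real (galton_watson \<xi> t x)) =
      (\<Prod>i<t. env_beta \<omega> (Suc i) / env_p \<omega> (Suc i))"
    and ln_expectation_galton_watson: "ln (expectation (\<lambda>x. real (galton_watson \<xi> t x))) =
      (\<Sum>i<t. ln (env_beta \<omega> (Suc i) / env_p \<omega> (Suc i)))"
proof -
  let ?m = "\<lambda>i. env_beta \<omega> (Suc i) / env_p \<omega> (Suc i)"
  have m: "0 < ?m i" for i using env by simp
  show *: "(\<integral>\<^sup>+x. of_nat (galton_watson \<xi> t x) \<partial>Q) = ennreal (\<Prod>i<t. ?m i)"
  proof (induction t)
    case 0
    show ?case by (simp add: emeasure_space_1)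
  next
    case (Suc t)
    have "(\<integral>\<^sup>+x. of_nat (galton_watson \<xi> (Suc t) x) \<partial>Q) = ennreal (\<Prod>i<t. ?m i) * ennreal (?m t)"
      using env[rule_format, of "Suc t"]
      by (subst nn_integral_galton_watson_Suc) (simp_all only: Suc.IH le_add1 One_nat_def Suc_le_mono less_imp_le)
    also have "\<dots> = ennreal (\<Prod>i<Suc t. ?m i)"
      by (simp only: prod.lessThan_Suc) (intro ennreal_mult[symmetric] prod_nonneg less_imp_le m)
    finally show ?case .
  qed
  have pos: "0 < (\<Prod>i<t. ?m i)" by (intro prod_pos m)
  have "has_bochner_integral Q (\<lambda>x. real (galton_watson \<xi> t x)) (\<Prod>i<t. ?m i)"
    using * pos
    by (intro has_bochner_integral_nn_integral) (auto simp: ennreal_of_nat_eq_real_of_nat)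
  then show "integrable Q (\<lambda>x. real (galton_watson \<xi> t x))"
    and E: "expectation (\<lambda>x. real (galton_watson \<xi> t x)) = (\<Prod>i<t. ?m i)"
    by (auto simp: has_bochner_integral_iff)
  show "ln (expectation (\<lambda>x. real (galton_watson \<xi> t x))) = (\<Sum>i<t. ln (?m i))"
    unfolding E by (rule ln_prod[OF finite_lessThan]) (rule less_imp_neq[OF m, symmetric])
qed

text \<open>Markov's inequality at level 1, followed by monotonicity of the logarithm.\<close>

lemma ln_survival_le:
  assumes env: "\<forall>t\<ge>1. 0 < env_p \<omega> t \<and> env_p \<omega> t < 1 \<and> 0 < env_beta \<omega> t"
  shows "ln (prob {x \<in> space Q. galton_watson \<xi> t x \<ge> 1}) \<le>
    ln (expectation (\<lambda>x. real (galton_watson \<xi> t x)))"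
proof -
  let ?S = "{x \<in> space Q. galton_watson \<xi> t x \<ge> 1}"
  note int = integrable_galton_watson[OF env, of t]
  have E: "expectation (\<lambda>x. real (galton_watson \<xi> t x)) > 0"
    unfolding expectation_galton_watson[OF env] by (intro prod_pos) (use env in auto)
  \<comment> \<open>\<open>ln\<close> is real-valued, so at 0 it does not return minus infinity, and
    comparing logarithms needs a positive probability. Certain extinction by time t would make the
    positive mean vanish.\<close>
  have "prob ?S \<noteq> 0"
  proof
    assume "prob ?S = 0"
    then have "AE x in Q. \<not> galton_watson \<xi> t x \<ge> 1"
      by (subst AE_iff_measurable[of ?S]) (auto simp: emeasure_eq_measure)
    then have "expectation (\<lambda>x. real (galton_watson \<xi> t x)) = 0"
      by (intro integral_eq_zero_AE) auto
    with E show False by simp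
  qed
  then have "0 < prob ?S" by (simp add: zero_less_measure_iff)
  moreover have "prob ?S \<le> expectation (\<lambda>x. real (galton_watson \<xi> t x))"
    using integral_Markov_inequality_measure[OF int, of "{}" 1] by simp
  ultimately show ?thesis by simp
qed

end

section \<open>The random walk of logarithmic means in the random environment\<close>

context iid_environment
begin

text \<open>The underlying space is a product of open unit squares, so the bounds hold for every
  environment and not merely almost surely.\<close>

lemma env_bounds:
  assumes "\<omega> \<in> space Pm"
  shows "\<forall>t\<ge>1. 0 < env_p \<omega> t \<and> env_p \<omega> t < 1 \<and> 0 < env_beta \<omega> t"
proof (intro allI impI)
  fix t :: nat assume "1 \<le> t"
  then have "\<omega> t \<in> {0<..<1} \<times> {0<..<1}"
    using assms sets_eq_imp_space_eq[OF sets_env]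
    by (auto simp: space_PiM unit_square_def space_restrict_space PiE_iff)
  then show "0 < env_p \<omega> t \<and> env_p \<omega> t < 1 \<and> 0 < env_beta \<omega> t"
    by (auto simp: env_p_def env_beta_def env_alpha_def mem_Times_iff)
qed

text \<open>The steps are one measurable function of the i.i.d. pairs, hence i.i.d. whatever the
  dependence within a pair. The successor shifts generations, counted from 1, to a sequence starting
  at 0.\<close>

lemma limsup_average_log_mean_neg:
  assumes int: "integrable Pm (\<lambda>\<omega>. ln (env_beta \<omega> 1 / env_p \<omega> 1))"
    and neg: "expectation (\<lambda>\<omega>. ln (env_beta \<omega> 1 / env_p \<omega> 1)) < 0"
  shows "AE \<omega> in Pm. limsup (\<lambda>t. ereal (1 / real t *
    (\<Sum>i<t. ln (env_beta \<omega> (Suc i) / env_p \<omega> (Suc i))))) < 0"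
proof -
  define g :: "real \<times> real \<Rightarrow> real" where "g = (\<lambda>z. ln ((1 - snd z) / fst z))"
  have g [measurable]: "g \<in> borel_measurable unit_square"
    unfolding g_def unit_square_def borel_prod[symmetric] by (rule measurable_restrict_space1) measurable
  have g_env: "ln (env_beta \<omega> t / env_p \<omega> t) = g (\<omega> t)" for \<omega> t
    by (simp add: g_def env_beta_def env_alpha_def env_p_def)
  have [measurable]: "(\<lambda>\<omega>. \<omega> t) \<in> Pm \<rightarrow>\<^sub>M unit_square" if "1 \<le> t" for t
    using indep_env that by (auto simp: indep_vars_def)
  have "AE \<omega> in Pm. limsup (\<lambda>t. ereal (1 / real t * (\<Sum>i<t. g (\<omega> (Suc i))))) < 0"
  proof (rule iid_average_limsup_neg)
    have "indep_vars (\<lambda>_. unit_square) (\<lambda>i \<omega>. \<omega> (Suc i)) UNIV"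
      by (rule indep_vars_reindex[OF indep_vars_subset[OF indep_env]]) auto
    then show "indep_vars (\<lambda>_. borel) (\<lambda>i \<omega>. g (\<omega> (Suc i))) UNIV"
      by (rule indep_vars_compose2) simp
    have "distr Pm borel (\<lambda>\<omega>. g (\<omega> (Suc i))) = distr (distr Pm unit_square (\<lambda>\<omega>. \<omega> (Suc i))) borel g" for i
      by (subst distr_distr) (auto simp: comp_def)
    then show "distr Pm borel (\<lambda>\<omega>. g (\<omega> (Suc i))) = distr Pm borel (\<lambda>\<omega>. g (\<omega> (Suc 0)))" for i
      using ident_env[of "Suc i"] by simp
  qed (use int neg in \<open>simp_all add: g_env\<close>)
  then show ?thesis by (simp add: g_env)
qed

end

theorem theorem3p3:
  fixes Pm :: "env measure"
    and Q :: "env \<Rightarrow> 'x measure"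
    and \<xi> :: "nat \<Rightarrow> nat \<Rightarrow> 'x \<Rightarrow> nat"
  assumes "iid_environment Pm"
    and "\<And>\<omega>. \<omega> \<in> space Pm \<Longrightarrow> quenched_offspring (Q \<omega>) \<omega> \<xi>"
    and "integrable Pm (\<lambda>\<omega>. ln (env_beta \<omega> 1 / env_p \<omega> 1))"
    and "(\<integral>\<omega>. ln (env_beta \<omega> 1 / env_p \<omega> 1) \<partial>Pm) < 0"
  shows "AE \<omega> in Pm.
      limsup (\<lambda>t. ereal (1 / real t * ln (\<integral>x. real (galton_watson \<xi> t x) \<partial>Q \<omega>))) < 0 \<and>
      limsup (\<lambda>t. ereal (1 / real t *
        ln (measure (Q \<omega>) {x \<in> space (Q \<omega>). galton_watson \<xi> t x \<ge> 1}))) < 0"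
proof -
  interpret iid_environment Pm by fact
  from limsup_average_log_mean_neg[OF assms(3,4)] AE_space show ?thesis
  proof eventually_elim
    fix \<omega> assume "\<omega> \<in> space Pm"
      and lim: "limsup (\<lambda>t. ereal (1 / real t *
        (\<Sum>i<t. ln (env_beta \<omega> (Suc i) / env_p \<omega> (Suc i))))) < 0"
    interpret Q: quenched_offspring "Q \<omega>" \<omega> \<xi> by (rule assms(2)) fact
    note env = env_bounds[OF \<open>\<omega> \<in> space Pm\<close>]
    have E: "limsup (\<lambda>t. ereal (1 / real t * ln (\<integral>x. real (galton_watson \<xi> t x) \<partial>Q \<omega>))) < 0"
      unfolding Q.ln_expectation_galton_watson[OF env] by (rule lim)
    \<comment> \<open>The comparison holds for every t in this fixed environment, so the survival
      bound holds on the same almost sure event as the bound for the mean.\<close>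
    have "limsup (\<lambda>t. ereal (1 / real t * ln (Q.prob {x \<in> space (Q \<omega>). galton_watson \<xi> t x \<ge> 1})))
        \<le> limsup (\<lambda>t. ereal (1 / real t * ln (\<integral>x. real (galton_watson \<xi> t x) \<partial>Q \<omega>)))"
      using Q.ln_survival_le[OF env] by (intro Limsup_mono always_eventually) (auto intro!: divide_right_mono)
    with E show "limsup (\<lambda>t. ereal (1 / real t * ln (\<integral>x. real (galton_watson \<xi> t x) \<partial>Q \<omega>))) < 0 \<and>
      limsup (\<lambda>t. ereal (1 / real t *
        ln (measure (Q \<omega>) {x \<in> space (Q \<omega>). galton_watson \<xi> t x \<ge> 1}))) < 0"
      by simp
  qed
qed

end
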